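(* Let $n\geq 1$. 1. For every $x\in A_n\setminus A_{n-1}$ and every $y\in A_n$ there exists a map $\psi:A_n\to A_n$ which is Tent-continuable and satisfies $\psi(x)=y$. 2. Let $\psi_1,\psi_2:A_n\to A_n$ be Tent-continuable and let $\psi_1(x)=\psi_2(x)$ for some $x\in A_n\setminus A_{n-1}$. Then $\psi_1(x)=\psi_2(x)$ for all $x\in A_n$.
   Context: The Tent-map is $f:[0,1]\to[0,1]$, $f(x)=2x$ for $x<1/2$ and $f(x)=2-2x$ for $x\geq 1/2$. $A_n=f^{-n}(0)$ is the complete pre-image of $0$ under the $n$-th iterate $f^n$; thus $A_0=\{0\}$ and $A_n=\{k/2^{n-1}: 0\leq k\leq 2^{n-1}\}$ for $n\geq 1$. A map $\psi:A_n\to[0,1]$ is called Tent-continuable if there exists a continuous $\xi:[0,1]\to[0,1]$ such that $\xi\circ f=f\circ\xi$ and $\xi(x)=\psi(x)$ for all $x\in A_n$. *)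

theory Defs
  imports Complex_Main "HOL-Library.FuncSet"
begin

text \<open>Maps between subsets of the reals are represented by total functions on \<^typ>\<open>real\<close>;
  only their values on the intended domain matter, and every condition below is relativised
  to that domain.\<close>

definition tent :: "real \<Rightarrow> real" where
  "tent x = (if x < 1/2 then 2 * x else 2 - 2 * x)"

definition tent_preimage :: "nat \<Rightarrow> real set" where
  "tent_preimage n = {x \<in> {0..1}. (tent ^^ n) x = 0}"

definition tent_continuable :: "nat \<Rightarrow> (real \<Rightarrow> real) \<Rightarrow> bool" where
  "tent_continuable n \<psi> \<longleftrightarrow>
     \<psi> \<in> tent_preimage n \<rightarrow> {0..1} \<and>
     (\<exists>\<xi>. \<xi> \<in> {0..1} \<rightarrow> {0..1} \<and> continuous_on {0..1} \<xi> \<and>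
          (\<forall>x\<in>{0..1}. \<xi> (tent x) = tent (\<xi> x)) \<and>
          (\<forall>x\<in>tent_preimage n. \<xi> x = \<psi> x))"

end

theory Submission
  imports Defs "HOL-Analysis.Elementary_Metric_Spaces" "HOL-Number_Theory.Cong"
begin

text \<open>Let \<open>T = zigzag\<close> be the even triangle wave of period 2 with \<open>T x = x\<close> on \<open>[0,1]\<close>; then
  \<open>f\<^sup>k(x) = T(2\<^sup>k x)\<close>, and \<open>x \<mapsto> T(r x)\<close> commutes with \<open>f\<close> for every integer \<open>r\<close>. Part 1
  amounts to solving \<open>r k = j\<close> modulo \<open>2\<^sup>n\<close> with \<open>k\<close> odd.

  For part 2 the point is that a continuous \<open>\<xi>\<close> that commutes with \<open>f\<close> and fixes 0 is of the form
  \<open>T(L x)\<close>. By uniform continuity and the intermediate value theorem applied to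
  \<open>T(2\<^sup>k \<xi>(x)) = \<xi>(T(2\<^sup>k x))\<close>, such a \<open>\<xi>\<close> is Lipschitz. Let \<open>L\<close> be its best Lipschitz constant. A
  chord of slope almost \<open>\<plusminus>L\<close> forces \<open>\<xi>\<close> to be almost affine between its endpoints;
  blowing up a dyadic subinterval of comparable length by \<open>f\<^sup>k\<close> shows that \<open>\<xi>\<close> is uniformly close
  to \<open>T(\<beta> \<plusminus> L x)\<close>, where \<open>\<xi>(0) = 0\<close> makes \<open>T(\<beta>)\<close> small.\<close>

section \<open>The triangle wave\<close>

text \<open>This is the distance from \<open>x\<close> to the nearest even integer.\<close>

definition zigzag :: "real \<Rightarrow> real" where
  "zigzag x = \<bar>x - 2 * of_int (round (x / 2))\<bar>"

lemma zigzag_le: "zigzag x \<le> \<bar>x - 2 * of_int m\<bar>"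
proof -
  have "\<bar>x / 2 - of_int (round (x / 2))\<bar> \<le> \<bar>x / 2 - of_int m\<bar>"
    by (rule round_diff_minimal)
  then show ?thesis unfolding zigzag_def by linarith
qed

lemma zigzag_nonneg: "0 \<le> zigzag x"
  by (simp add: zigzag_def)

lemma zigzag_le_1: "zigzag x \<le> 1"
proof -
  have "\<bar>of_int (round (x / 2)) - x / 2\<bar> \<le> 1 / 2"
    by (rule of_int_round_abs_le)
  then show ?thesis unfolding zigzag_def by linarith
qed

lemma zigzag_obtain:
  obtains m :: int where "x = 2 * of_int m + zigzag x \<or> x = 2 * of_int m - zigzag x"
proof (rule that)
  show "x = 2 * of_int (round (x / 2)) + zigzag x \<or> x = 2 * of_int (round (x / 2)) - zigzag x"
    unfolding zigzag_def by linarith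
qed

text \<open>Every even integer other than \<open>2 * m\<close> is at distance at least
  \<open>2 - y\<close> from \<open>x\<close>, and \<open>2 - y\<close> is at least
  \<open>y\<close>.\<close>

lemma zigzag_eqI:
  assumes "x = 2 * of_int m + y \<or> x = 2 * of_int m - y" "0 \<le> y" "y \<le> 1"
  shows "zigzag x = y"
proof (rule antisym)
  show "zigzag x \<le> y" using zigzag_le[of x m] assms by linarith
  define d where "d = round (x / 2) - m"
  have eq: "zigzag x = \<bar>x - 2 * of_int m - 2 * of_int d\<bar>"
    by (simp add: zigzag_def d_def algebra_simps)
  consider "d = 0" | "d \<ge> 1" | "d \<le> -1" by linarith
  then show "y \<le> zigzag x"
  proof cases
    case 1 then show ?thesis using eq assms by auto
  next
    case 2
    then have "real_of_int d \<ge> 1" by simp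
    then show ?thesis using eq assms by linarith
  next
    case 3
    then have "real_of_int d \<le> -1" by linarith
    then show ?thesis using eq assms by linarith
  qed
qed

lemma zigzag_id: "0 \<le> x \<Longrightarrow> x \<le> 1 \<Longrightarrow> zigzag x = x"
  by (rule zigzag_eqI[where m = 0]) auto

text \<open>The unit interval is a fundamental domain for the group generated by negation and
  translation by 2. This turns equations between values of \<open>zigzag\<close> into
  congruences.\<close>

lemma zigzag_eq_iff:
  "zigzag a = zigzag b \<longleftrightarrow> (\<exists>m::int. a - b = 2 * of_int m \<or> a + b = 2 * of_int m)"
proof
  assume eq: "zigzag a = zigzag b"
  obtain m where m: "a = 2 * of_int m + zigzag a \<or> a = 2 * of_int m - zigzag a"
    by (rule zigzag_obtain)
  obtain k where k: "b = 2 * of_int k + zigzag b \<or> b = 2 * of_int k - zigzag b"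
    by (rule zigzag_obtain)
  have "a - b = 2 * of_int (m - k) \<or> a + b = 2 * of_int (m + k)"
    using m k eq by auto
  then show "\<exists>m::int. a - b = 2 * of_int m \<or> a + b = 2 * of_int m" by blast
next
  assume "\<exists>m::int. a - b = 2 * of_int m \<or> a + b = 2 * of_int m"
  then obtain m :: int where m: "a - b = 2 * of_int m \<or> a + b = 2 * of_int m" by blast
  obtain k where k: "b = 2 * of_int k + zigzag b \<or> b = 2 * of_int k - zigzag b"
    by (rule zigzag_obtain)
  from m show "zigzag a = zigzag b"
  proof
    assume "a - b = 2 * of_int m"
    with k show ?thesis
      by (intro zigzag_eqI[where m = "m + k"] zigzag_nonneg zigzag_le_1) auto
  next
    assume "a + b = 2 * of_int m"
    with k show ?thesis
      by (intro zigzag_eqI[where m = "m - k"] zigzag_nonneg zigzag_le_1) auto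
  qed
qed

lemma zigzag_add_even: "zigzag (2 * of_int m + x) = zigzag x"
  unfolding zigzag_eq_iff by (rule exI[of _ m]) simp

lemma zigzag_minus: "zigzag (- x) = zigzag x"
  unfolding zigzag_eq_iff by (rule exI[of _ 0]) simp

text \<open>Multiplication by an integer respects congruence modulo 2 up to sign. Hence the maps
  given by different integers \<open>r\<close> commute with one another; the tent map is the case
  \<open>r = 2\<close>.\<close>

lemma zigzag_mult_zigzag: "zigzag (of_int r * zigzag x) = zigzag (of_int r * x)"
proof -
  obtain m where "x = 2 * of_int m + zigzag x \<or> x = 2 * of_int m - zigzag x"
    by (rule zigzag_obtain)
  then show ?thesis
  proof
    assume "x = 2 * of_int m + zigzag x"
    then have "of_int r * x = of_int r * (2 * of_int m + zigzag x)" by simp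
    also have "\<dots> = 2 * of_int (r * m) + of_int r * zigzag x" by (simp add: algebra_simps)
    finally show ?thesis by (simp only: zigzag_add_even)
  next
    assume "x = 2 * of_int m - zigzag x"
    then have "of_int r * x = of_int r * (2 * of_int m - zigzag x)" by simp
    also have "\<dots> = 2 * of_int (r * m) + - (of_int r * zigzag x)" by (simp add: algebra_simps)
    finally show ?thesis by (simp only: zigzag_add_even zigzag_minus)
  qed
qed

text \<open>The even integers nearest to \<open>u\<close> and \<open>v\<close> add up to a candidate
  for \<open>u + v\<close>.\<close>

lemma zigzag_add_le: "zigzag (u + v) \<le> zigzag u + zigzag v"
  using zigzag_le[of "u + v" "round (u / 2) + round (v / 2)"]
  by (simp add: zigzag_def[of u] zigzag_def[of v])

lemma zigzag_le_abs: "zigzag x \<le> \<bar>x\<bar>"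
  using zigzag_le[of x 0] by simp

text \<open>Sharper than the Lipschitz bound: it lets a shift be discarded when only its
  \<open>zigzag\<close> is small.\<close>

lemma abs_zigzag_diff_le_zigzag: "\<bar>zigzag x - zigzag y\<bar> \<le> zigzag (x - y)"
  using zigzag_add_le[of "x - y" y] zigzag_add_le[of "y - x" x] zigzag_minus[of "x - y"] by simp

lemma abs_zigzag_diff_le: "\<bar>zigzag x - zigzag y\<bar> \<le> \<bar>x - y\<bar>"
  using abs_zigzag_diff_le_zigzag[of x y] zigzag_le_abs[of "x - y"] by linarith

lemma continuous_on_zigzag: "continuous_on S (\<lambda>x. zigzag (c * x))"
proof (rule continuous_on_compose2[of UNIV zigzag])
  show "continuous_on UNIV zigzag"
    unfolding continuous_on_iff dist_real_def
    using abs_zigzag_diff_le by (meson order_le_less_trans)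
qed (auto intro!: continuous_intros)

lemma abs_zigzag_int_diff: "\<bar>zigzag (of_int j) - zigzag (of_int j + 1)\<bar> = 1"
proof (cases "even j")
  case True
  then obtain i where "j = 2 * i" by auto
  then show ?thesis
    using zigzag_add_even[of i 0] zigzag_add_even[of i 1] by (simp add: zigzag_id)
next
  case False
  then obtain i where "j = 2 * i + 1" using oddE by blast
  then show ?thesis
    using zigzag_add_even[of i 1] zigzag_add_even[of "i + 1" 0]
    by (simp add: zigzag_id algebra_simps)
qed

text \<open>An explicit inverse of \<open>zigzag\<close> on \<open>[j, j + 1]\<close>, where the
  wave rises for even \<open>j\<close> and falls for odd \<open>j\<close>.\<close>

lemma zigzag_onto_unit_interval:
  assumes "0 \<le> z" "z \<le> 1"
  shows "zigzag (of_int j + (if even j then z else 1 - z)) = z"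
proof (cases "even j")
  case True
  then obtain i where "j = 2 * i" by auto
  then show ?thesis using zigzag_add_even[of i z] assms by (simp add: zigzag_id)
next
  case False
  then obtain i where "j = 2 * i + 1" using oddE by blast
  then show ?thesis using assms
    by (intro zigzag_eqI[where m = "i + 1"]) auto
qed

section \<open>Iterates of the tent map and the preimages of 0\<close>

lemma tent_eq_zigzag: "0 \<le> x \<Longrightarrow> x \<le> 1 \<Longrightarrow> tent x = zigzag (2 * x)"
  unfolding tent_def
  by (cases "x < 1/2") (auto intro!: zigzag_eqI[where m = 1, symmetric] zigzag_id[symmetric])

lemma tent_zigzag: "tent (zigzag x) = zigzag (2 * x)"
  using tent_eq_zigzag[OF zigzag_nonneg zigzag_le_1, of x] zigzag_mult_zigzag[of 2 x] by simp

lemma funpow_tent: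
  assumes "0 \<le> x" "x \<le> 1"
  shows "(tent ^^ n) x = zigzag (2 ^ n * x)"
  by (induction n) (simp_all add: assms zigzag_id tent_zigzag mult.assoc)

text \<open>\<open>zigzag\<close> vanishes exactly at the even integers. Writing the condition with
  \<open>2 ^ n\<close> instead of \<open>2 ^ (n - 1)\<close> covers \<open>n = 0\<close> as
  well.\<close>

lemma mem_tent_preimage:
  "x \<in> tent_preimage n \<longleftrightarrow> 0 \<le> x \<and> x \<le> 1 \<and> (\<exists>k::int. 2 ^ n * x = 2 * of_int k)"
proof -
  have "zigzag y = 0 \<longleftrightarrow> (\<exists>k::int. y = 2 * of_int k)" for y
    using zigzag_eq_iff[of y 0] zigzag_id[of 0] by simp
  then show ?thesis by (auto simp: tent_preimage_def funpow_tent)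
qed

text \<open>An even numerator would cancel against the denominator and put \<open>x\<close> into the
  previous level. Odd numerators are units modulo \<open>2 ^ n\<close>, which drives both parts of
  the theorem.\<close>

lemma mem_tent_preimage_diffE:
  assumes "x \<in> tent_preimage n - tent_preimage (n - 1)" "n \<ge> 1"
  obtains k :: int where "2 ^ n * x = 2 * of_int k" "odd k"
proof -
  from assms obtain k :: int where x: "0 \<le> x" "x \<le> 1" and k: "2 ^ n * x = 2 * of_int k"
    by (auto simp: mem_tent_preimage)
  have "odd k"
  proof
    assume "even k"
    then obtain i where "k = 2 * i" by auto
    then have i: "real_of_int k = 2 * of_int i" by simp
    have "2 * (2 ^ (n - 1) * x) = 2 ^ n * x"
      using \<open>n \<ge> 1\<close> by (cases n) auto
    then have "2 ^ (n - 1) * x = 2 * of_int i" using k i by linarith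
    then have "x \<in> tent_preimage (n - 1)" using x by (auto simp only: mem_tent_preimage)
    then show False using assms by blast
  qed
  with k show ?thesis using that by blast
qed

section \<open>Rigidity of continuous maps commuting with the tent map\<close>

text \<open>The least \<open>k\<close> with \<open>c < 2 ^ Suc k * d\<close> works. It is the power
  of two that magnifies an interval of length \<open>d\<close> to a length comparable with
  \<open>c\<close>.\<close>

lemma dyadic_scale:
  fixes d c :: real
  assumes "0 < d" "d \<le> c"
  obtains k :: nat where "2 ^ k * d \<le> c" "c < 2 * (2 ^ k * d)"
proof -
  have "\<exists>k. c < 2 ^ Suc k * d"
  proof -
    obtain k where "c / d < 2 ^ k" using real_arch_pow[of 2 "c / d"] by auto
    then have "c < 2 ^ k * d" using assms by (simp add: field_simps)
    also have "\<dots> \<le> 2 ^ Suc k * d" using assms by simp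
    finally show ?thesis by blast
  qed
  then obtain k where k: "c < 2 ^ Suc k * d" "\<And>i. i < k \<Longrightarrow> \<not> c < 2 ^ Suc i * d"
    using exists_least_iff[of "\<lambda>k. c < 2 ^ Suc k * d"] by auto
  have "2 ^ k * d \<le> c"
    using k(2)[of "k - 1"] assms by (cases k) auto
  then show ?thesis using k(1) that by (simp add: mult.assoc)
qed

locale tent_commuting =
  fixes \<xi> :: "real \<Rightarrow> real"
  assumes maps_unit: "\<And>x. 0 \<le> x \<Longrightarrow> x \<le> 1 \<Longrightarrow> 0 \<le> \<xi> x \<and> \<xi> x \<le> 1"
    and cont: "continuous_on {0..1} \<xi>"
    and commute: "\<And>x. 0 \<le> x \<Longrightarrow> x \<le> 1 \<Longrightarrow> \<xi> (tent x) = tent (\<xi> x)"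
begin

lemma commute_zigzag:
  assumes "0 \<le> x" "x \<le> 1"
  shows "\<xi> (zigzag (2 ^ k * x)) = zigzag (2 ^ k * \<xi> x)"
proof (induction k)
  case 0
  then show ?case using assms maps_unit by (simp add: zigzag_id)
next
  case (Suc k)
  have "\<xi> (zigzag (2 * (2 ^ k * x))) = tent (\<xi> (zigzag (2 ^ k * x)))"
    using commute[OF zigzag_nonneg zigzag_le_1, of "2 ^ k * x"] by (simp add: tent_zigzag)
  then show ?case by (simp add: Suc tent_zigzag mult.assoc)
qed

text \<open>If \<open>2\<^sup>k \<xi>\<close> varied by 2 it would take two consecutive integer values, at which \<open>T\<close> differs
  by 1.\<close>

lemma oscillation_lt_2:
  assumes \<delta>: "\<And>x y. \<lbrakk>0 \<le> x; x \<le> 1; 0 \<le> y; y \<le> 1; \<bar>x - y\<bar> \<le> \<delta>\<rbrakk> \<Longrightarrow> \<bar>\<xi> x - \<xi> y\<bar> < 1"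
    and xy: "0 \<le> x" "x \<le> y" "y \<le> 1" "2 ^ k * (y - x) \<le> \<delta>"
  shows "2 ^ k * \<bar>\<xi> y - \<xi> x\<bar> < 2"
proof (rule ccontr)
  assume "\<not> ?thesis"
  then have ge: "\<bar>2 ^ k * \<xi> y - 2 ^ k * \<xi> x\<bar> \<ge> 2"
    by (simp add: abs_mult flip: right_diff_distrib)
  define a where "a = min (2 ^ k * \<xi> x) (2 ^ k * \<xi> y)"
  define b where "b = max (2 ^ k * \<xi> x) (2 ^ k * \<xi> y)"
  have ab: "b \<ge> a + 2" using ge unfolding a_def b_def by linarith
  have cont': "continuous_on {x..y} (\<lambda>x. 2 ^ k * \<xi> x)"
    using xy by (intro continuous_intros continuous_on_subset[OF cont]) auto
  have conn: "connected ((\<lambda>x. 2 ^ k * \<xi> x) ` {x..y})"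
    by (intro connected_continuous_image[OF cont']) simp
  have ends: "a \<in> (\<lambda>x. 2 ^ k * \<xi> x) ` {x..y}" "b \<in> (\<lambda>x. 2 ^ k * \<xi> x) ` {x..y}"
    using xy by (auto simp: a_def b_def min_def max_def)
  have ivt: "\<exists>s. x \<le> s \<and> s \<le> y \<and> 2 ^ k * \<xi> s = c" if "a \<le> c" "c \<le> b" for c
    using connectedD_interval[OF conn ends that] by auto
  \<comment> \<open>A gap of 2 leaves room in \<open>[a, b]\<close> for two consecutive
    integers.\<close>
  have "a \<le> of_int \<lceil>a\<rceil>" "of_int \<lceil>a\<rceil> + 1 \<le> b" using ab by linarith+
  then obtain s t where s: "x \<le> s" "s \<le> y" "2 ^ k * \<xi> s = of_int \<lceil>a\<rceil>"
    and t: "x \<le> t" "t \<le> y" "2 ^ k * \<xi> t = of_int \<lceil>a\<rceil> + 1"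
    using ivt[of "of_int \<lceil>a\<rceil>"] ivt[of "of_int \<lceil>a\<rceil> + 1"] by (smt (verit))
  \<comment> \<open>Since \<open>zigzag\<close> does not expand distances, the images of
    \<open>s\<close> and \<open>t\<close> under the iterate are still within
    \<open>\<delta>\<close>.\<close>
  have "\<bar>zigzag (2 ^ k * s) - zigzag (2 ^ k * t)\<bar> \<le> \<bar>2 ^ k * s - 2 ^ k * t\<bar>"
    by (rule abs_zigzag_diff_le)
  also have "\<dots> = 2 ^ k * \<bar>s - t\<bar>" by (simp add: abs_mult flip: right_diff_distrib)
  also have "\<dots> \<le> 2 ^ k * (y - x)" using s t by (intro mult_left_mono) auto
  also have "\<dots> \<le> \<delta>" by fact
  finally have "\<bar>\<xi> (zigzag (2 ^ k * s)) - \<xi> (zigzag (2 ^ k * t))\<bar> < 1"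
    by (intro \<delta> zigzag_nonneg zigzag_le_1)
  then show False
    using s t xy abs_zigzag_int_diff[of "\<lceil>a\<rceil>"] by (simp add: commute_zigzag)
qed

text \<open>Magnify a short chord until its width lies between \<open>\<delta> / 2\<close> and
  \<open>\<delta>\<close>. Its height is then below 2, so its slope is below
  \<open>4 / \<delta>\<close>. Chords wider than \<open>\<delta>\<close> have height at most
  1.\<close>

lemma lipschitz:
  obtains C where "\<And>x y. \<lbrakk>0 \<le> x; x < y; y \<le> 1\<rbrakk> \<Longrightarrow> \<bar>\<xi> y - \<xi> x\<bar> \<le> C * (y - x)"
proof -
  have "uniformly_continuous_on {0..1} \<xi>"
    by (intro compact_uniformly_continuous cont) simp
  then obtain e where e: "e > 0"
    "\<And>x y. \<lbrakk>x \<in> {0..1}; y \<in> {0..1}; dist y x < e\<rbrakk> \<Longrightarrow> dist (\<xi> y) (\<xi> x) < 1"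
    unfolding uniformly_continuous_on_def by (metis zero_less_one)
  \<comment> \<open>Halving \<open>e\<close> turns the strict bound of uniform continuity into the
    non-strict one of \<open>oscillation_lt_2\<close>.\<close>
  define \<delta> where "\<delta> = e / 2"
  have "\<delta> > 0" using e by (simp add: \<delta>_def)
  have \<delta>: "\<bar>\<xi> x - \<xi> y\<bar> < 1" if "0 \<le> x" "x \<le> 1" "0 \<le> y" "y \<le> 1" "\<bar>x - y\<bar> \<le> \<delta>" for x y
    using e(2)[of y x] that \<open>e > 0\<close> by (auto simp: dist_real_def \<delta>_def)
  have "\<bar>\<xi> y - \<xi> x\<bar> \<le> 4 / \<delta> * (y - x)" if xy: "0 \<le> x" "x < y" "y \<le> 1" for x y
  proof (cases "y - x \<le> \<delta>")
    case True
    then obtain k where k: "2 ^ k * (y - x) \<le> \<delta>" "\<delta> < 2 * (2 ^ k * (y - x))"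
      using dyadic_scale[of "y - x" \<delta>] xy by auto
    have "2 ^ k * \<bar>\<xi> y - \<xi> x\<bar> < 2"
      using oscillation_lt_2[OF \<delta>, where k = k and x = x and y = y] xy k by simp
    then have "\<delta> * (2 ^ k * \<bar>\<xi> y - \<xi> x\<bar>) \<le> \<delta> * 2"
      using \<open>\<delta> > 0\<close> by simp
    also have "\<dots> \<le> 2 ^ k * (4 * (y - x))" using k by (simp add: algebra_simps)
    finally have "2 ^ k * (\<delta> * \<bar>\<xi> y - \<xi> x\<bar>) \<le> 2 ^ k * (4 * (y - x))" by (simp add: mult_ac)
    then have "\<delta> * \<bar>\<xi> y - \<xi> x\<bar> \<le> 4 * (y - x)" by simp
    then show ?thesis using \<open>\<delta> > 0\<close> by (simp add: field_simps)
  next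
    case False
    then have "\<delta> < y - x" by simp
    also have "\<dots> \<le> 4 * (y - x)" using xy by simp
    finally have "\<delta> \<le> 4 * (y - x)" by simp
    then have "1 \<le> 4 / \<delta> * (y - x)" using \<open>\<delta> > 0\<close> by (simp add: field_simps)
    moreover have "\<bar>\<xi> y - \<xi> x\<bar> \<le> 1" using maps_unit[of x] maps_unit[of y] xy by auto
    ultimately show ?thesis by linarith
  qed
  then show ?thesis by (rule that)
qed

text \<open>\<open>L\<close> is the supremum of the absolute slopes of chords. It need not be
  attained, so the second property supplies chords that come within \<open>\<eta>\<close> of
  it.\<close>

lemma best_lipschitz:
  obtains L where "\<And>x y. \<lbrakk>0 \<le> x; x \<le> y; y \<le> 1\<rbrakk> \<Longrightarrow> \<bar>\<xi> y - \<xi> x\<bar> \<le> L * (y - x)"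
    and "\<And>\<eta>. \<eta> > 0 \<Longrightarrow> \<exists>x y. 0 \<le> x \<and> x < y \<and> y \<le> 1 \<and> (L - \<eta>) * (y - x) \<le> \<bar>\<xi> y - \<xi> x\<bar>"
proof -
  obtain C where C: "\<And>x y. \<lbrakk>0 \<le> x; x < y; y \<le> 1\<rbrakk> \<Longrightarrow> \<bar>\<xi> y - \<xi> x\<bar> \<le> C * (y - x)"
    using lipschitz by blast
  define S where "S = {\<bar>\<xi> y - \<xi> x\<bar> / (y - x) | x y. 0 \<le> x \<and> x < y \<and> y \<le> 1}"
  have "\<bar>\<xi> 1 - \<xi> 0\<bar> / (1 - 0) \<in> S" unfolding S_def by force
  then have "S \<noteq> {}" by blast
  have bdd: "bdd_above S"
    by (rule bdd_aboveI[of _ C]) (use C in \<open>auto simp: S_def pos_divide_le_eq\<close>)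
  show ?thesis
  proof (rule that[of "Sup S"])
    fix x y :: real assume xy: "0 \<le> x" "x \<le> y" "y \<le> 1"
    show "\<bar>\<xi> y - \<xi> x\<bar> \<le> Sup S * (y - x)"
    proof (cases "x = y")
      case False
      then have "\<bar>\<xi> y - \<xi> x\<bar> / (y - x) \<in> S" using xy unfolding S_def by force
      then have "\<bar>\<xi> y - \<xi> x\<bar> / (y - x) \<le> Sup S" using bdd by (rule cSup_upper)
      then show ?thesis using False xy by (simp add: pos_divide_le_eq)
    qed simp
  next
    fix \<eta> :: real assume "\<eta> > 0"
    then obtain q where "q \<in> S" "Sup S - \<eta> < q"
      using less_cSupE[OF _ \<open>S \<noteq> {}\<close>, of "Sup S - \<eta>"] by auto
    then obtain x y where xy: "0 \<le> x" "x < y" "y \<le> 1" "Sup S - \<eta> < \<bar>\<xi> y - \<xi> x\<bar> / (y - x)"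
      by (auto simp: S_def)
    then have "(Sup S - \<eta>) * (y - x) \<le> \<bar>\<xi> y - \<xi> x\<bar>" by (simp add: pos_less_divide_eq)
    with xy show "\<exists>x y. 0 \<le> x \<and> x < y \<and> y \<le> 1 \<and> (Sup S - \<eta>) * (y - x) \<le> \<bar>\<xi> y - \<xi> x\<bar>"
      by blast
  qed
qed

text \<open>Between the ends of a nearly extremal chord the graph deviates from a line of slope
  \<open>\<plusminus>L\<close> by at most \<open>\<eta> * (y - x)\<close>. Magnifying the chord to
  width at most 4 keeps this error below \<open>4 * \<eta>\<close>.\<close>

lemma blow_up_chord:
  assumes L: "\<And>x y. \<lbrakk>0 \<le> x; x \<le> y; y \<le> 1\<rbrakk> \<Longrightarrow> \<bar>\<xi> y - \<xi> x\<bar> \<le> L * (y - x)"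
    and xy: "0 \<le> x" "x < y" "y \<le> 1" "(L - \<eta>) * (y - x) \<le> \<bar>\<xi> y - \<xi> x\<bar>" and "\<eta> > 0"
  obtains \<beta> \<sigma> :: real where "\<sigma> = 1 \<or> \<sigma> = -1"
    and "\<And>z. 0 \<le> z \<Longrightarrow> z \<le> 1 \<Longrightarrow> \<bar>\<xi> z - zigzag (\<beta> + \<sigma> * L * z)\<bar> \<le> 4 * \<eta>"
proof -
  \<comment> \<open>The sign makes the chord non-decreasing; it disappears later because
    \<open>zigzag\<close> is even.\<close>
  define s :: real where "s = (if \<xi> x \<le> \<xi> y then 1 else -1)"
  have s: "s = 1 \<or> s = -1" by (simp add: s_def)
  have chord: "(L - \<eta>) * (y - x) \<le> s * \<xi> y - s * \<xi> x" using xy by (auto simp: s_def)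
  \<comment> \<open>The bound on \<open>[x, w]\<close> gives the upper estimate. The bound on
    \<open>[w, y]\<close>, subtracted from the rise of the whole chord, gives the lower one.\<close>
  have almost_affine: "\<bar>s * \<xi> w - (s * \<xi> x + L * (w - x))\<bar> \<le> \<eta> * (y - x)"
    if "x \<le> w" "w \<le> y" for w
  proof -
    have "\<bar>s * \<xi> w - s * \<xi> x\<bar> \<le> L * (w - x)" "\<bar>s * \<xi> y - s * \<xi> w\<bar> \<le> L * (y - w)"
      using L[of x w] L[of w y] that xy s by auto
    moreover have "0 \<le> \<eta> * (y - x)" using xy \<open>\<eta> > 0\<close> by simp
    ultimately show ?thesis using chord by (auto simp: algebra_simps abs_le_iff)
  qed
  \<comment> \<open>The magnified width lies in \<open>(2, 4]\<close>: more than 2 guarantees a full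
    interval \<open>[j, j + 1]\<close> inside, and at most 4 limits the error.\<close>
  obtain k where k: "2 ^ k * (y - x) \<le> 4" "4 < 2 * (2 ^ k * (y - x))"
    using dyadic_scale[of "y - x" 4] xy by auto
  define j where "j = \<lceil>2 ^ k * x\<rceil>"
  have "2 ^ k * x + 2 \<le> 2 ^ k * y" using k by (simp add: right_diff_distrib)
  then have j: "2 ^ k * x \<le> of_int j" "of_int j + 1 \<le> 2 ^ k * y"
    unfolding j_def by linarith+
  \<comment> \<open>\<open>\<sigma>\<close> and \<open>\<beta>\<close> come from expanding
    \<open>2 ^ k * (s * \<xi> x + L * (w - x))\<close> in \<open>z\<close>, where
    \<open>2 ^ k * w\<close> is \<open>j + z\<close> or \<open>j + 1 - z\<close>.\<close>
  define \<sigma> :: real where "\<sigma> = (if even j then 1 else -1)"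
  define \<beta> where "\<beta> = 2 ^ k * (s * \<xi> x - L * x) + L * (of_int j + (if even j then 0 else 1))"
  show ?thesis
  proof (rule that)
    show "\<sigma> = 1 \<or> \<sigma> = -1" by (simp add: \<sigma>_def)
    fix z :: real assume z: "0 \<le> z" "z \<le> 1"
    \<comment> \<open>\<open>w\<close> is a preimage of \<open>z\<close> under the
      \<open>k\<close>-th iterate, chosen inside \<open>[x, y]\<close>.\<close>
    define v where "v = of_int j + (if even j then z else 1 - z)"
    define w where "w = v / 2 ^ k"
    have v: "2 ^ k * w = v" by (simp add: w_def)
    have "2 ^ k * x \<le> v" "v \<le> 2 ^ k * y" using j z by (auto simp: v_def)
    then have w: "x \<le> w" "w \<le> y" by (simp_all flip: v)
    have "\<xi> z = \<xi> (zigzag (2 ^ k * w))"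
      unfolding v using zigzag_onto_unit_interval[OF z, of j] by (simp add: v_def)
    also have "\<dots> = zigzag (2 ^ k * \<xi> w)" using w xy by (intro commute_zigzag) auto
    also have "\<dots> = zigzag (2 ^ k * (s * \<xi> w))" using s zigzag_minus by auto
    finally have \<xi>z: "\<xi> z = zigzag (2 ^ k * (s * \<xi> w))" .
    have "\<beta> + \<sigma> * L * z = 2 ^ k * (s * \<xi> x - L * x) + L * v"
      by (simp add: \<beta>_def \<sigma>_def v_def algebra_simps)
    also have "\<dots> = 2 ^ k * (s * \<xi> x + L * (w - x))"
      by (simp add: algebra_simps flip: v)
    finally have "\<bar>\<xi> z - zigzag (\<beta> + \<sigma> * L * z)\<bar>
        \<le> \<bar>2 ^ k * (s * \<xi> w) - 2 ^ k * (s * \<xi> x + L * (w - x))\<bar>"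
      unfolding \<xi>z by (metis abs_zigzag_diff_le)
    also have "\<dots> = 2 ^ k * \<bar>s * \<xi> w - (s * \<xi> x + L * (w - x))\<bar>"
      by (simp add: abs_mult flip: right_diff_distrib)
    also have "\<dots> \<le> 2 ^ k * (\<eta> * (y - x))"
      using almost_affine[OF w] by (intro mult_left_mono) auto
    also have "\<dots> = \<eta> * (2 ^ k * (y - x))" by simp
    also have "\<dots> \<le> \<eta> * 4" using k \<open>\<eta> > 0\<close> by (intro mult_left_mono) auto
    finally show "\<bar>\<xi> z - zigzag (\<beta> + \<sigma> * L * z)\<bar> \<le> 4 * \<eta>" by simp
  qed
qed

text \<open>\<open>\<beta>\<close> and \<open>\<sigma>\<close> may change with the precision, but
  \<open>L\<close> does not. Evaluation at 0 bounds \<open>zigzag \<beta>\<close>, evenness removes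
  \<open>\<sigma>\<close>, and letting the error tend to 0 gives equality.\<close>

lemma eq_zigzag:
  assumes "\<xi> 0 = 0"
  obtains r :: int where "\<And>x. 0 \<le> x \<Longrightarrow> x \<le> 1 \<Longrightarrow> \<xi> x = zigzag (of_int r * x)"
proof -
  obtain L where L: "\<And>x y. \<lbrakk>0 \<le> x; x \<le> y; y \<le> 1\<rbrakk> \<Longrightarrow> \<bar>\<xi> y - \<xi> x\<bar> \<le> L * (y - x)"
    and chord: "\<And>\<eta>. \<eta> > 0 \<Longrightarrow>
      \<exists>x y. 0 \<le> x \<and> x < y \<and> y \<le> 1 \<and> (L - \<eta>) * (y - x) \<le> \<bar>\<xi> y - \<xi> x\<bar>"
    using best_lipschitz by blast
  have eq: "\<xi> z = zigzag (L * z)" if z: "0 \<le> z" "z \<le> 1" for z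
  proof -
    have "\<bar>\<xi> z - zigzag (L * z)\<bar> \<le> 0 + \<epsilon>" if "\<epsilon> > 0" for \<epsilon>
    proof -
      \<comment> \<open>The error \<open>4 * (\<epsilon> / 8)\<close> is spent twice: on the
        approximation at \<open>z\<close> and on dropping \<open>\<beta>\<close>.\<close>
      have \<eta>: "\<epsilon> / 8 > 0" using that by simp
      obtain x y where "0 \<le> x" "x < y" "y \<le> 1" "(L - \<epsilon> / 8) * (y - x) \<le> \<bar>\<xi> y - \<xi> x\<bar>"
        using chord[OF \<eta>] by blast
      then obtain \<beta> \<sigma> :: real where \<sigma>: "\<sigma> = 1 \<or> \<sigma> = -1"
        and close: "\<And>z. 0 \<le> z \<Longrightarrow> z \<le> 1 \<Longrightarrow> \<bar>\<xi> z - zigzag (\<beta> + \<sigma> * L * z)\<bar> \<le> 4 * (\<epsilon> / 8)"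
        using blow_up_chord[OF L _ _ _ _ \<eta>] by metis
      have "zigzag \<beta> \<le> \<epsilon> / 2" using close[of 0] assms by simp
      moreover have "\<bar>zigzag (\<beta> + \<sigma> * L * z) - zigzag (\<sigma> * L * z)\<bar> \<le> zigzag \<beta>"
        using abs_zigzag_diff_le_zigzag[of "\<beta> + \<sigma> * L * z" "\<sigma> * L * z"] by simp
      moreover have "zigzag (\<sigma> * L * z) = zigzag (L * z)" using \<sigma> zigzag_minus by auto
      ultimately show ?thesis using close[OF z] by linarith
    qed
    then have "\<bar>\<xi> z - zigzag (L * z)\<bar> \<le> 0" by (rule field_le_epsilon)
    then show ?thesis by simp
  qed
  \<comment> \<open>The tent map sends 1 to 0, so commutation at 1 makes \<open>2 * L\<close> an
    even integer.\<close>
  have "tent (\<xi> 1) = 0" using commute[of 1] assms by (simp add: tent_def)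
  then have "zigzag (2 * L) = zigzag 0" using eq[of 1] by (simp add: tent_zigzag zigzag_id)
  then obtain r :: int where "L = of_int r" unfolding zigzag_eq_iff by auto
  with eq show ?thesis using that by blast
qed

end

section \<open>Tent-continuable self-maps of the preimage sets\<close>

text \<open>Commutation makes \<open>\<psi> 0\<close> a fixed point of the tent map. That
  \<open>\<psi>\<close> takes values in \<open>tent_preimage n\<close> then forces it to be 0, so
  \<open>eq_zigzag\<close> applies.\<close>

lemma tent_continuable_eq_zigzag:
  assumes "tent_continuable n \<psi>" "\<psi> \<in> tent_preimage n \<rightarrow> tent_preimage n"
  obtains r :: int where "\<And>x. x \<in> tent_preimage n \<Longrightarrow> \<psi> x = zigzag (of_int r * x)"
proof -
  obtain \<xi> where \<xi>: "\<xi> \<in> {0..1} \<rightarrow> {0..1}" "continuous_on {0..1} \<xi>"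
    "\<forall>x\<in>{0..1}. \<xi> (tent x) = tent (\<xi> x)" and \<psi>: "\<forall>x\<in>tent_preimage n. \<xi> x = \<psi> x"
    using assms(1) unfolding tent_continuable_def by blast
  interpret tent_commuting \<xi>
    by standard (use \<xi> in \<open>auto simp: Pi_iff\<close>)
  have "0 \<in> tent_preimage n" by (auto simp: mem_tent_preimage)
  then have mem: "\<xi> 0 \<in> tent_preimage n" using \<psi> assms(2) by auto
  then obtain k :: int where k: "2 ^ n * \<xi> 0 = 2 * of_int k"
    by (auto simp: mem_tent_preimage)
  have "\<xi> 0 = 0"
  proof (rule ccontr)
    \<comment> \<open>The only other fixed point of the tent map is 2/3, which is not dyadic.\<close>
    assume "\<xi> 0 \<noteq> 0"
    moreover have "tent (\<xi> 0) = \<xi> 0" using commute[of 0] by (simp add: tent_def)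
    ultimately have "3 * \<xi> 0 = 2" by (auto simp: tent_def split: if_splits)
    then have "2 * 2 ^ n = 3 * (2 ^ n * \<xi> 0)" by simp
    then have "real_of_int (2 ^ n) = of_int (3 * k)" using k by simp
    then have "(2::int) ^ n = 3 * k" by (simp only: of_int_eq_iff)
    then have "(3::int) dvd 2 ^ n" by simp
    moreover have "coprime (3::int) (2 ^ n)" by simp
    ultimately have "is_unit (3::int)"
      using coprime_common_divisor[of "3::int" "2 ^ n" 3] by simp
    then show False by simp
  qed
  then obtain r :: int where "\<And>x. 0 \<le> x \<Longrightarrow> x \<le> 1 \<Longrightarrow> \<xi> x = zigzag (of_int r * x)"
    using eq_zigzag by blast
  then have "\<psi> x = zigzag (of_int r * x)" if "x \<in> tent_preimage n" for x
    using \<psi> that by (metis mem_tent_preimage)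
  then show ?thesis by (rule that)
qed

text \<open>The map commutes with the \<open>n\<close>-th iterate and fixes 0.\<close>

lemma zigzag_maps_tent_preimage:
  assumes "x \<in> tent_preimage n"
  shows "zigzag (of_int r * x) \<in> tent_preimage n"
proof -
  obtain k :: int where k: "2 ^ n * x = 2 * of_int k" using assms by (auto simp: mem_tent_preimage)
  have "(tent ^^ n) (zigzag (of_int r * x)) = zigzag (of_int (2 ^ n) * zigzag (of_int r * x))"
    by (simp add: funpow_tent zigzag_nonneg zigzag_le_1)
  also have "\<dots> = zigzag (of_int r * (2 ^ n * x))"
    unfolding zigzag_mult_zigzag by (simp add: mult_ac)
  also have "\<dots> = zigzag (2 * of_int (r * k) + 0)" using k by (simp add: mult_ac)
  also have "\<dots> = 0" unfolding zigzag_add_even by (simp add: zigzag_id)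
  finally show ?thesis by (simp add: tent_preimage_def zigzag_nonneg zigzag_le_1)
qed

lemma tent_continuable_zigzag: "tent_continuable n (\<lambda>x. zigzag (of_int r * x))"
  unfolding tent_continuable_def
proof (intro conjI exI ballI)
  fix x :: real assume "x \<in> {0..1}"
  then have "zigzag (of_int r * tent x) = zigzag (of_int r * (2 * x))"
    by (simp add: tent_eq_zigzag zigzag_mult_zigzag)
  then show "zigzag (of_int r * tent x) = tent (zigzag (of_int r * x))"
    by (simp add: tent_zigzag mult_ac)
qed (auto simp: zigzag_nonneg zigzag_le_1 intro: continuous_on_zigzag)

lemma zigzag_hits_tent_preimage:
  assumes "x \<in> tent_preimage n - tent_preimage (n - 1)" "n \<ge> 1" "y \<in> tent_preimage n"
  obtains r :: int where "zigzag (of_int r * x) = y"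
proof -
  obtain k :: int where k: "2 ^ n * x = 2 * of_int k" "odd k"
    using mem_tent_preimage_diffE[OF assms(1,2)] .
  obtain j :: int where j: "0 \<le> y" "y \<le> 1" "2 ^ n * y = 2 * of_int j"
    using assms by (auto simp: mem_tent_preimage)
  have "coprime k (2 ^ n)" using \<open>odd k\<close> by simp
  \<comment> \<open>With \<open>i\<close> inverse to \<open>k\<close>, the multiplier
    \<open>i * j\<close> solves the congruence.\<close>
  then obtain i where "[k * i = 1] (mod 2 ^ n)" using cong_solve_coprime_int by blast
  then have "[k * i * j = 1 * j] (mod 2 ^ n)" by (intro cong_mult cong_refl)
  then obtain c where c: "k * i * j - j = 2 ^ n * c" by (auto simp: cong_iff_dvd_diff)
  have "2 ^ n * (of_int (i * j) * x - y) = of_int (i * j) * (2 ^ n * x) - 2 ^ n * y"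
    by (simp add: algebra_simps)
  also have "\<dots> = 2 * of_int (k * i * j - j)" using k j by (simp add: algebra_simps)
  also have "\<dots> = 2 ^ n * (2 * of_int c)" unfolding c by simp
  finally have "of_int (i * j) * x - y = 2 * of_int c" by simp
  then have "zigzag (of_int (i * j) * x) = zigzag y" unfolding zigzag_eq_iff by blast
  then have "zigzag (of_int (i * j) * x) = y" using j by (simp only: zigzag_id)
  then show ?thesis by (rule that)
qed

text \<open>Agreement at \<open>x\<close> says that \<open>2 ^ n\<close> divides
  \<open>(r - s) * k\<close> or \<open>(r + s) * k\<close> with \<open>k\<close> odd. So it divides
  \<open>r - s\<close> or \<open>r + s\<close>, which gives agreement at every
  \<open>y\<close>.\<close>

lemma zigzag_determined_on_tent_preimage:
  assumes "x \<in> tent_preimage n - tent_preimage (n - 1)" "n \<ge> 1"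
    and eq: "zigzag (of_int r * x) = zigzag (of_int s * x)" and y: "y \<in> tent_preimage n"
  shows "zigzag (of_int r * y) = zigzag (of_int s * y)"
proof -
  obtain k :: int where k: "2 ^ n * x = 2 * of_int k" "odd k"
    using mem_tent_preimage_diffE[OF assms(1,2)] .
  obtain j :: int where j: "2 ^ n * y = 2 * of_int j"
    using y by (auto simp: mem_tent_preimage)
  \<comment> \<open>Here \<open>t\<close> stands for either of \<open>r - s\<close> and
    \<open>r + s\<close>.\<close>
  have *: "\<exists>m::int. of_int t * y = 2 * of_int m" if m: "of_int t * x = 2 * of_int m" for t m :: int
  proof -
    have "2 * real_of_int (t * k) = of_int t * (2 ^ n * x)" using k by simp
    also have "\<dots> = 2 ^ n * (of_int t * x)" by simp
    also have "\<dots> = 2 * of_int (2 ^ n * m)" using m by simp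
    finally have "real_of_int (t * k) = of_int (2 ^ n * m)" by simp
    then have "t * k = 2 ^ n * m" by (simp only: of_int_eq_iff)
    then have "2 ^ n dvd t * k" by simp
    then have "2 ^ n dvd t" using \<open>odd k\<close> by (simp add: coprime_dvd_mult_left_iff)
    then obtain c where "t = 2 ^ n * c" by auto
    then have "of_int t * y = of_int c * (2 ^ n * y)" by simp
    also have "\<dots> = 2 * of_int (c * j)" using j by simp
    finally show ?thesis by blast
  qed
  obtain m :: int where "of_int (r - s) * x = 2 * of_int m \<or> of_int (r + s) * x = 2 * of_int m"
    using eq unfolding zigzag_eq_iff by (auto simp: algebra_simps)
  then obtain m :: int where "of_int (r - s) * y = 2 * of_int m \<or> of_int (r + s) * y = 2 * of_int m"
    using * by blast
  then show ?thesis unfolding zigzag_eq_iff by (auto simp: algebra_simps)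
qed


theorem theorem4:
  fixes n :: nat
  assumes "n \<ge> 1"
  shows "(\<forall>x \<in> tent_preimage n - tent_preimage (n - 1). \<forall>y \<in> tent_preimage n.
            \<exists>\<psi>. \<psi> \<in> tent_preimage n \<rightarrow> tent_preimage n \<and> tent_continuable n \<psi> \<and> \<psi> x = y) \<and>
         (\<forall>\<psi>\<^sub>1 \<psi>\<^sub>2. \<psi>\<^sub>1 \<in> tent_preimage n \<rightarrow> tent_preimage n \<longrightarrow> tent_continuable n \<psi>\<^sub>1 \<longrightarrow>
            \<psi>\<^sub>2 \<in> tent_preimage n \<rightarrow> tent_preimage n \<longrightarrow> tent_continuable n \<psi>\<^sub>2 \<longrightarrow>
            (\<exists>x \<in> tent_preimage n - tent_preimage (n - 1). \<psi>\<^sub>1 x = \<psi>\<^sub>2 x) \<longrightarrow>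
            (\<forall>x \<in> tent_preimage n. \<psi>\<^sub>1 x = \<psi>\<^sub>2 x))"
proof (intro conjI ballI allI impI)
  fix x y assume "x \<in> tent_preimage n - tent_preimage (n - 1)" "y \<in> tent_preimage n"
  then obtain r :: int where "zigzag (of_int r * x) = y"
    using zigzag_hits_tent_preimage assms by blast
  then show "\<exists>\<psi>. \<psi> \<in> tent_preimage n \<rightarrow> tent_preimage n \<and> tent_continuable n \<psi> \<and> \<psi> x = y"
    using zigzag_maps_tent_preimage tent_continuable_zigzag
    by (intro exI[of _ "\<lambda>x. zigzag (of_int r * x)"]) auto
next
  fix \<psi>\<^sub>1 \<psi>\<^sub>2 y
  assume \<psi>\<^sub>1: "\<psi>\<^sub>1 \<in> tent_preimage n \<rightarrow> tent_preimage n" "tent_continuable n \<psi>\<^sub>1"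
    and \<psi>\<^sub>2: "\<psi>\<^sub>2 \<in> tent_preimage n \<rightarrow> tent_preimage n" "tent_continuable n \<psi>\<^sub>2"
    and ex: "\<exists>x \<in> tent_preimage n - tent_preimage (n - 1). \<psi>\<^sub>1 x = \<psi>\<^sub>2 x"
    and y: "y \<in> tent_preimage n"
  obtain r :: int where r: "\<And>x. x \<in> tent_preimage n \<Longrightarrow> \<psi>\<^sub>1 x = zigzag (of_int r * x)"
    using tent_continuable_eq_zigzag \<psi>\<^sub>1 by blast
  obtain s :: int where s: "\<And>x. x \<in> tent_preimage n \<Longrightarrow> \<psi>\<^sub>2 x = zigzag (of_int s * x)"
    using tent_continuable_eq_zigzag \<psi>\<^sub>2 by blast
  obtain x where x: "x \<in> tent_preimage n - tent_preimage (n - 1)" "\<psi>\<^sub>1 x = \<psi>\<^sub>2 x"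
    using ex by blast
  then have "zigzag (of_int r * x) = zigzag (of_int s * x)" using r s by auto
  then have "zigzag (of_int r * y) = zigzag (of_int s * y)"
    by (rule zigzag_determined_on_tent_preimage[OF x(1) assms _ y])
  then show "\<psi>\<^sub>1 y = \<psi>\<^sub>2 y" using r[OF y] s[OF y] by simp
qed

end
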